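(* Let $E$ be an effect algebra. Then $E$ is atomistic if and only if $E$ is atomic and disjunctive.
   Context: An effect algebra is an algebraic structure $(E,\oplus,\mathbf{0},\mathbf{1})$ where $E$ is a set, $\mathbf{0}\neq\mathbf{1}$ are elements of $E$, and $\oplus$ is a partial binary operation on $E$ such that for all $a,b,c\in E$: (1) $a\oplus b=b\oplus a$ if $a\oplus b$ exists (in particular $b\oplus a$ then exists); (2) $(a\oplus b)\oplus c=a\oplus(b\oplus c)$ if $(a\oplus b)\oplus c$ exists (in particular the right-hand side then exists); (3) there is a unique $a'\in E$ such that $a\oplus a'=\mathbf{1}$; (4) $a=\mathbf{0}$ whenever $a\oplus\mathbf{1}$ is defined. The partial order on $E$ is defined by $a\le b$ iff there is $c\in E$ with $b=a\oplus c$; $\mathbf{0}$ is the least and $\mathbf{1}$ the greatest element. Suprema $\bigvee$, $\vee$ and infima $\wedge$ are taken with respect to this order, and need not exist in general; $c\wedge b=\mathbf{0}$ means that the infimum of $c$ and $b$ exists and equals $\mathbf{0}$. An atom of $E$ is a minimal element of $E\setminus\{\mathbf{0}\}$. $E$ is atomic if for every nonzero $a\in E$ there is an atom less than or equal to $a$. $E$ is atomistic if every nonzero element of $E$ is the supremum of a set of atoms (equivalently, of the set of all atoms it dominates). $E$ is disjunctive if for all $a,b\in E$ with $a\not\le b$ there is a nonzero $c\in E$ such that $c\le a$ and $c\wedge b=\mathbf{0}$. *)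

theory Defs
  imports "HOL-Algebra.Order"
begin

text \<open>The partial operation is modelled by \<^typ>\<open>'a option\<close>, with \<^term>\<open>None\<close> standing for
  ``undefined''; only its values on the carrier \<open>E\<close> are constrained.\<close>

locale effect_algebra =
  fixes E :: "'a set"
    and oplus :: "'a \<Rightarrow> 'a \<Rightarrow> 'a option"
    and zero one :: 'a
  assumes zero_closed: "zero \<in> E"
    and one_closed: "one \<in> E"
    and zero_neq_one: "zero \<noteq> one"
    and oplus_closed: "\<lbrakk>a \<in> E; b \<in> E; oplus a b = Some c\<rbrakk> \<Longrightarrow> c \<in> E"
    and oplus_commute: "\<lbrakk>a \<in> E; b \<in> E; oplus a b = Some c\<rbrakk> \<Longrightarrow> oplus b a = Some c"
    and oplus_assoc:
      "\<lbrakk>a \<in> E; b \<in> E; c \<in> E; oplus a b = Some d; oplus d c = Some e\<rbrakk>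
        \<Longrightarrow> \<exists>f. oplus b c = Some f \<and> oplus a f = Some e"
    and orthosupplement: "a \<in> E \<Longrightarrow> \<exists>!a'. a' \<in> E \<and> oplus a a' = Some one"
    and zero_one_law: "\<lbrakk>a \<in> E; oplus a one \<noteq> None\<rbrakk> \<Longrightarrow> a = zero"

definition effect_order :: "'a set \<Rightarrow> ('a \<Rightarrow> 'a \<Rightarrow> 'a option) \<Rightarrow> 'a gorder" where
  "effect_order E oplus =
    \<lparr>carrier = E, eq = (=), le = (\<lambda>a b. \<exists>c\<in>E. oplus a c = Some b)\<rparr>"

text \<open>\<^term>\<open>is_lub L a A\<close> and \<^term>\<open>is_glb L a A\<close> assert that the supremum (infimum) of \<open>A\<close>
  exists and equals \<open>a\<close>, whereas the total operations of \<open>HOL-Algebra.Lattice\<close> return an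
  arbitrary value when the bound does not exist.\<close>

definition atoms :: "('a, 'b) gorder_scheme \<Rightarrow> 'a \<Rightarrow> 'a set" where
  "atoms L zero = {p \<in> carrier L - {zero}.
    \<forall>x \<in> carrier L - {zero}. x \<sqsubseteq>\<^bsub>L\<^esub> p \<longrightarrow> x = p}"

definition atomic :: "('a, 'b) gorder_scheme \<Rightarrow> 'a \<Rightarrow> bool" where
  "atomic L zero \<longleftrightarrow> (\<forall>a \<in> carrier L - {zero}. \<exists>p \<in> atoms L zero. p \<sqsubseteq>\<^bsub>L\<^esub> a)"

definition atomistic :: "('a, 'b) gorder_scheme \<Rightarrow> 'a \<Rightarrow> bool" where
  "atomistic L zero \<longleftrightarrow>
    (\<forall>a \<in> carrier L - {zero}. \<exists>A \<subseteq> atoms L zero. is_lub L a A)"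

definition disjunctive :: "('a, 'b) gorder_scheme \<Rightarrow> 'a \<Rightarrow> bool" where
  "disjunctive L zero \<longleftrightarrow>
    (\<forall>a \<in> carrier L. \<forall>b \<in> carrier L. \<not> a \<sqsubseteq>\<^bsub>L\<^esub> b \<longrightarrow>
      (\<exists>c \<in> carrier L - {zero}. c \<sqsubseteq>\<^bsub>L\<^esub> a \<and> is_glb L zero {c, b}))"

end

theory Submission
  imports Defs
begin

text \<open>Only the induced order matters: the equivalence holds in every partially ordered set with
  a least element. If \<open>a\<close> is the supremum of atoms and \<open>a \<le> b\<close> fails, one of these atoms is not
  below \<open>b\<close> and hence meets \<open>b\<close> in zero. Conversely, let \<open>b\<close> bound all atoms below \<open>a\<close>; if
  \<open>a \<le> b\<close> failed, disjunctivity would give a nonzero \<open>c \<le> a\<close> with \<open>c \<and> b = 0\<close>, and an atom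
  below \<open>c\<close> would lie below \<open>b\<close> as well.\<close>

context effect_algebra
begin

text \<open>By commutativity the orthosupplement \<open>z\<close> of \<open>one\<close> can be added
  to \<open>one\<close> from the left, so the zero-one law forces \<open>z = zero\<close>.\<close>

lemma oplus_zero_one: "oplus zero one = Some one"
proof -
  obtain z where z: "z \<in> E" "oplus one z = Some one"
    using orthosupplement one_closed by blast
  then have "oplus z one = Some one"
    using oplus_commute one_closed by blast
  then show ?thesis
    using zero_one_law[OF z(1)] by auto
qed

text \<open>Reassociating (a' + a) + 0 = 1 shows that a + 0 is defined and, like a itself, an
  orthosupplement of a'. Uniqueness identifies the two.\<close>

lemma oplus_zero_right:
  assumes a: "a \<in> E"
  shows "oplus a zero = Some a"
proof -
  obtain a' where a': "a' \<in> E" "oplus a a' = Some one"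
    using orthosupplement a by blast
  then have a'a: "oplus a' a = Some one"
    using oplus_commute a by blast
  have "oplus one zero = Some one"
    using oplus_zero_one oplus_commute zero_closed one_closed by blast
  with a'a obtain f where f: "oplus a zero = Some f" "oplus a' f = Some one"
    using oplus_assoc a a' zero_closed by blast
  moreover have "f \<in> E"
    using f oplus_closed a zero_closed by blast
  ultimately show ?thesis
    using orthosupplement[OF a'(1)] a a'a by auto
qed

text \<open>Reassociating (f + a) + a' = a + a' = 1 turns the left side into f + 1, to which the
  zero-one law applies.\<close>

lemma oplus_eq_self_imp_zero:
  assumes a: "a \<in> E" and f: "f \<in> E" and eq: "oplus a f = Some a"
  shows "f = zero"
proof -
  obtain a' where a': "a' \<in> E" "oplus a a' = Some one"
    using orthosupplement a by blast
  have "oplus f a = Some a"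
    using oplus_commute a f eq by blast
  then have "oplus f one = Some one"
    using oplus_assoc[OF f a a'(1)] a'(2) by force
  then show ?thesis
    using zero_one_law[OF f] by simp
qed

text \<open>Positivity: (c + d) + 1 = 0 + 1 is defined, hence so is d + 1, and the zero-one law
  applies to \<open>d\<close>.\<close>

lemma oplus_eq_zero_imp_zero:
  assumes "c \<in> E" "d \<in> E" "oplus c d = Some zero"
  shows "d = zero"
proof -
  obtain f where "oplus d one = Some f"
    using oplus_assoc[OF assms(1,2) one_closed assms(3) oplus_zero_one] by blast
  then show ?thesis
    using zero_one_law[OF assms(2)] by simp
qed

lemma effect_order_partial_order: "partial_order (effect_order E oplus)"
proof (rule partial_order.intro)
  show "partial_order_axioms (effect_order E oplus)"
    by (simp add: partial_order_axioms_def effect_order_def)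
  show "weak_partial_order (effect_order E oplus)"
  proof
    fix x assume "x \<in> carrier (effect_order E oplus)"
    then show "x \<sqsubseteq>\<^bsub>effect_order E oplus\<^esub> x"
      using oplus_zero_right zero_closed by (auto simp: effect_order_def)
  next
    fix x y
    assume "x \<sqsubseteq>\<^bsub>effect_order E oplus\<^esub> y" "y \<sqsubseteq>\<^bsub>effect_order E oplus\<^esub> x"
      and "x \<in> carrier (effect_order E oplus)" "y \<in> carrier (effect_order E oplus)"
    then obtain c d where x: "x \<in> E" and y: "y \<in> E"
      and c: "c \<in> E" "oplus x c = Some y" and d: "d \<in> E" "oplus y d = Some x"
      by (auto simp: effect_order_def)
    \<comment> \<open>Going up from \<open>x\<close> to \<open>y\<close> and back to
      \<open>x\<close> adds c + d in total; this sum must vanish, and by positivity so must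
      \<open>d\<close>.\<close>
    obtain f where f: "oplus c d = Some f" "oplus x f = Some x"
      using oplus_assoc[OF x c(1) d(1) c(2) d(2)] by blast
    then have "f = zero"
      using oplus_eq_self_imp_zero oplus_closed x c(1) d(1) by blast
    then have "d = zero"
      using oplus_eq_zero_imp_zero f c d by blast
    then show "x .=\<^bsub>effect_order E oplus\<^esub> y"
      using d oplus_zero_right y by (simp add: effect_order_def)
  next
    fix x y z
    assume "x \<sqsubseteq>\<^bsub>effect_order E oplus\<^esub> y" "y \<sqsubseteq>\<^bsub>effect_order E oplus\<^esub> z"
      and "x \<in> carrier (effect_order E oplus)"
    then obtain c d where x: "x \<in> E" and c: "c \<in> E" "oplus x c = Some y"
      and d: "d \<in> E" "oplus y d = Some z"
      by (auto simp: effect_order_def)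
    obtain f where f: "oplus c d = Some f" "oplus x f = Some z"
      using oplus_assoc[OF x c(1) d(1) c(2) d(2)] by blast
    then have "f \<in> E"
      using oplus_closed c d by blast
    with f show "x \<sqsubseteq>\<^bsub>effect_order E oplus\<^esub> z"
      by (auto simp: effect_order_def)
  qed (auto simp: effect_order_def)
qed

lemma effect_order_least: "least (effect_order E oplus) zero E"
proof -
  have "oplus zero a = Some a" if "a \<in> E" for a
    using that oplus_zero_right oplus_commute zero_closed by blast
  then show ?thesis
    using zero_closed by (auto simp: least_def effect_order_def)
qed

end

context partial_order
begin

lemma atomistic_iff_atomic_disjunctive:
  assumes zero: "least L zero (carrier L)"
  shows "atomistic L zero \<longleftrightarrow> atomic L zero \<and> disjunctive L zero"
proof (intro iffI conjI)
  have zero_in: "zero \<in> carrier L" and zero_le: "\<And>x. x \<in> carrier L \<Longrightarrow> zero \<sqsubseteq> x"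
    using zero by (auto simp: least_def)
  {
    assume atomistic: "atomistic L zero"
    \<comment> \<open>Both conclusions come from this: \<open>b = zero\<close> gives atomicity, and
      for general \<open>b\<close> the atom \<open>p\<close> is the witness for
      disjunctivity.\<close>
    have below: "\<exists>p\<in>atoms L zero. p \<sqsubseteq> a \<and> \<not> p \<sqsubseteq> b"
      if a: "a \<in> carrier L" and b: "b \<in> carrier L" and nle: "\<not> a \<sqsubseteq> b" for a b
    proof -
      have "a \<noteq> zero"
        using nle zero_le b by blast
      then obtain A where A: "A \<subseteq> atoms L zero" "is_lub L a A"
        using atomistic a by (auto simp: atomistic_def)
      \<comment> \<open>Otherwise \<open>b\<close> would be an upper bound of \<open>A\<close>, and
        so above the least one, \<open>a\<close>.\<close>
      then have "\<exists>p\<in>A. \<not> p \<sqsubseteq> b"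
        using nle b by (auto simp: least_def Upper_def)
      moreover have "\<forall>p\<in>A. p \<sqsubseteq> a"
        using A by (auto simp: least_def Upper_def atoms_def)
      ultimately show ?thesis
        using A by blast
    qed
    show "atomic L zero"
      unfolding atomic_def
    proof
      fix a assume a: "a \<in> carrier L - {zero}"
      then have "\<not> a \<sqsubseteq> zero"
        using le_antisym[OF _ zero_le[of a] _ zero_in] by auto
      then show "\<exists>p\<in>atoms L zero. p \<sqsubseteq> a"
        using below[of a zero] a zero_in by auto
    qed
    show "disjunctive L zero"
      unfolding disjunctive_def
    proof (intro ballI impI)
      fix a b assume a: "a \<in> carrier L" and b: "b \<in> carrier L" and "\<not> a \<sqsubseteq> b"
      then obtain p where p: "p \<in> atoms L zero" "p \<sqsubseteq> a" "\<not> p \<sqsubseteq> b"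
        using below[of a b] by blast
      have glb: "x \<sqsubseteq> zero" if x: "x \<in> carrier L" "x \<sqsubseteq> p" "x \<sqsubseteq> b" for x
      proof -
        \<comment> \<open>A nonzero \<open>x\<close> below the atom \<open>p\<close> would equal
          \<open>p\<close>, but \<open>p\<close> is not below \<open>b\<close>.\<close>
        have "x = zero"
          using p x by (auto simp: atoms_def)
        then show ?thesis
          using zero_in by simp
      qed
      have p_in: "p \<in> carrier L" "p \<noteq> zero"
        using p(1) by (auto simp: atoms_def)
      have "is_glb L zero {p, b}"
      proof (rule greatest_LowerI)
        show "zero \<sqsubseteq> x" if "x \<in> {p, b}" for x
          using that zero_le[OF b] zero_le[OF p_in(1)] by auto
        show "y \<sqsubseteq> zero" if "y \<in> Lower L {p, b}" for y
          using that glb[of y] p_in(1) b by (simp add: Lower_def)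
      qed (use p_in b zero_in in auto)
      then show "\<exists>c\<in>carrier L - {zero}. c \<sqsubseteq> a \<and> is_glb L zero {c, b}"
        by (intro bexI[of _ p] conjI) (use p(2) p_in in simp_all)
    qed
  }
  assume ad: "atomic L zero \<and> disjunctive L zero"
  show "atomistic L zero"
    unfolding atomistic_def
  proof
    fix a assume a: "a \<in> carrier L - {zero}"
    \<comment> \<open>With all atoms below \<open>a\<close> chosen, \<open>a\<close> is an upper
      bound by construction; only leastness needs an argument.\<close>
    let ?A = "{p \<in> atoms L zero. p \<sqsubseteq> a}"
    have "a \<sqsubseteq> b" if b: "b \<in> carrier L" and ub: "\<And>p. p \<in> ?A \<Longrightarrow> p \<sqsubseteq> b" for b
    proof (rule ccontr)
      assume "\<not> a \<sqsubseteq> b"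
      then obtain c where c: "c \<in> carrier L - {zero}" "c \<sqsubseteq> a" "is_glb L zero {c, b}"
        using ad a b unfolding disjunctive_def by blast
      then obtain p where p: "p \<in> atoms L zero" "p \<sqsubseteq> c"
        using ad unfolding atomic_def by blast
      then have p_in: "p \<in> carrier L" "p \<noteq> zero"
        by (auto simp: atoms_def)
      have "p \<sqsubseteq> a"
        using le_trans[OF p(2) c(2)] p_in c a by blast
      then have "p \<sqsubseteq> b"
        using ub p by blast
      \<comment> \<open>\<open>p\<close> is a common lower bound of \<open>c\<close> and
        \<open>b\<close>, whose infimum is \<open>zero\<close>.\<close>
      then have "p \<sqsubseteq> zero"
        using c p p_in by (auto simp: greatest_def Lower_def)
      then show False
        using le_antisym[OF _ zero_le[of p] _ zero_in] p_in by auto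
    qed
    then have "is_lub L a ?A"
      using a by (auto simp: least_def Upper_def atoms_def)
    then show "\<exists>A\<subseteq>atoms L zero. is_lub L a A"
      by (intro exI[of _ ?A] conjI) auto
  qed
qed

end

theorem theorem3p2:
  fixes E :: "'a set"
    and oplus :: "'a \<Rightarrow> 'a \<Rightarrow> 'a option"
    and zero one :: 'a
  assumes "effect_algebra E oplus zero one"
  shows "atomistic (effect_order E oplus) zero \<longleftrightarrow>
    atomic (effect_order E oplus) zero \<and> disjunctive (effect_order E oplus) zero"
proof -
  have "carrier (effect_order E oplus) = E"
    by (simp add: effect_order_def)
  then show ?thesis
    using partial_order.atomistic_iff_atomic_disjunctive[OF
        effect_algebra.effect_order_partial_order[OF assms]]
      effect_algebra.effect_order_least[OF assms]
    by simp
qed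

end
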